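(* Let $k$ be a positive integer and let $G$ be a connected graph of order $n$ with minimum degree $\delta$. Then $G$ contains a spanning tree $T$ with $$SW_k(T) \leq \frac{k-1}{k+1}\,\frac{3(n+1)}{\delta+1}\binom{n}{k} + \Big(\frac{3\delta}{\delta+1}+2k\Big)\binom{n}{k}.$$
   Context: All graphs are finite and simple; the order of a graph is its number of vertices. For a non-empty set $S$ of vertices of a connected graph $G$, the Steiner distance $d_G(S)$ is the minimum size (number of edges) of a connected subgraph of $G$ containing all vertices of $S$. For a positive integer $k$, the Steiner $k$-Wiener index of a connected graph $G$ is $SW_k(G)=\sum_{S\subseteq V(G),\,|S|=k} d_G(S)$. For the spanning tree $T$, the Steiner distances in $SW_k(T)$ are taken in $T$. *)

theory Defs
  imports Complex_Main
begin

record 'a ugraph =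
  verts :: "'a set"
  edges :: "'a set set"

definition simple_graph :: "'a ugraph \<Rightarrow> bool" where
  "simple_graph G \<longleftrightarrow> finite (verts G) \<and> (\<forall>e\<in>edges G. e \<subseteq> verts G \<and> card e = 2)"

definition degree :: "'a ugraph \<Rightarrow> 'a \<Rightarrow> nat" where
  "degree G v = card {e \<in> edges G. v \<in> e}"

text \<open>Meaningful only for a finite nonempty vertex set.\<close>

definition min_degree :: "'a ugraph \<Rightarrow> nat" where
  "min_degree G = Min (degree G ` verts G)"

text \<open>The null graph is not regarded as connected.\<close>

definition connected_graph :: "'a ugraph \<Rightarrow> bool" where
  "connected_graph G \<longleftrightarrow> verts G \<noteq> {} \<and>
     (\<forall>u\<in>verts G. \<forall>v\<in>verts G. (u, v) \<in> {(x, y). {x, y} \<in> edges G}\<^sup>*)"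

definition subgraph :: "'a ugraph \<Rightarrow> 'a ugraph \<Rightarrow> bool" where
  "subgraph H G \<longleftrightarrow> simple_graph H \<and> verts H \<subseteq> verts G \<and> edges H \<subseteq> edges G"

text \<open>A cycle is given by the list of its vertices, without repeating the first one at the end.\<close>

definition is_cycle :: "'a ugraph \<Rightarrow> 'a list \<Rightarrow> bool" where
  "is_cycle G p \<longleftrightarrow> length p \<ge> 3 \<and> distinct p \<and>
     (\<forall>i<length p. {p ! i, p ! (Suc i mod length p)} \<in> edges G)"

definition tree :: "'a ugraph \<Rightarrow> bool" where
  "tree T \<longleftrightarrow> simple_graph T \<and> connected_graph T \<and> (\<nexists>p. is_cycle T p)"

definition spanning_tree :: "'a ugraph \<Rightarrow> 'a ugraph \<Rightarrow> bool" where
  "spanning_tree T G \<longleftrightarrow> subgraph T G \<and> verts T = verts G \<and> tree T"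

text \<open>The minimum is over a nonempty set when \<open>G\<close> is a connected simple graph and
  \<open>S \<subseteq> verts G\<close>, since \<open>G\<close> itself is then a candidate.\<close>

definition steiner_distance :: "'a ugraph \<Rightarrow> 'a set \<Rightarrow> nat" where
  "steiner_distance G S =
     (LEAST m. \<exists>H. subgraph H G \<and> connected_graph H \<and> S \<subseteq> verts H \<and> card (edges H) = m)"

definition steiner_wiener :: "nat \<Rightarrow> 'a ugraph \<Rightarrow> nat" where
  "steiner_wiener k G = (\<Sum>S | S \<subseteq> verts G \<and> card S = k. steiner_distance G S)"

end

theory Submission
  imports Defs
begin

text \<open>
  Write \<open>C = \<delta> + 1\<close>. The tree \<open>T\<close> is built around a maximal packing of disjoint closed
  neighbourhoods, grown one at a time: as long as some closed neighbourhood misses the current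
  tree, connectedness of \<open>G\<close> supplies such a vertex \<open>b\<close> with a neighbour \<open>x\<close> that is adjacent to the
  tree, and the star at \<open>b\<close> is hooked on through \<open>x\<close> (\<open>clustering_extend\<close>). When this is no longer
  possible, every remaining vertex has a neighbour in the tree and becomes a leaf
  (\<open>spanning_clustering\<close>). The vertices of \<open>T\<close> are thus divided into clusters of size at least \<open>C\<close>,
  each with a centre at distance at most 2 from its members, and the clusters form a rooted tree
  \<open>0, \<dots>, m\<close> in which the centres of a cluster and its parent have distance at most 3 in \<open>T\<close>.

  For a set \<open>S\<close> of \<open>k\<close> vertices, connect each of them to its centre and then connect the centres along
  the tree of clusters. Only those cluster-tree edges are needed that have members of \<open>S\<close> on both
  sides, so \<open>d\<^sub>T(S)\<close> is at most three times the number of such edges plus \<open>2k\<close>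
  (\<open>steiner_distance_via_cuts\<close>). Exchanging sums, \<open>SW\<^sub>k(T)\<close> is bounded by three times the sum of
  \<open>f(a\<^sub>e)\<close> over the cluster-tree edges \<open>e\<close>, plus \<open>2k\<close> times the number of \<open>k\<close>-sets. Here \<open>a\<^sub>e\<close> is the
  number of vertices on one side of \<open>e\<close>, and \<open>f(a)\<close> counts the \<open>k\<close>-sets that meet both parts when
  \<open>n\<close> points are split into \<open>a\<close> and \<open>n - a\<close>.

  The last sum is compared with a path of single vertices, for which every split \<open>i = 0, \<dots>, n\<close> counts
  once and the total is \<open>(k - 1) / (k + 1) (n + 1)\<close> times the number of \<open>k\<close>-sets (\<open>path_total\<close>). The
  function \<open>f\<close> increases with the size of the smaller part, so it is enough to compare, for each \<open>t\<close>,
  how many splits have both parts of size at least \<open>t\<close>. On the path there are \<open>n - 2t + 1\<close>. In the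
  cluster tree, two disjoint end pieces of size at least \<open>t\<close> leave room for only
  \<open>(n - 2t) / C\<close> further clusters, so there are at most \<open>(n - 2t) / C + 1\<close> such edges
  (\<open>balanced_cuts\<close>). Hence the sum of \<open>f(a\<^sub>e)\<close> is at most \<open>1 / C\<close> times the path total plus
  \<open>(C - 1) / C\<close> times the number of \<open>k\<close>-sets (\<open>total_cuts\<close>).
\<close>

section \<open>Steiner distance\<close>

lemma steiner_distance_le:
  assumes "subgraph H G" "connected_graph H" "S \<subseteq> verts H" "card (edges H) \<le> m"
  shows "steiner_distance G S \<le> m"
proof -
  have "steiner_distance G S \<le> card (edges H)"
    unfolding steiner_distance_def using assms by (intro Least_le) blast
  with assms(4) show ?thesis by simp
qed

lemma steiner_distance_attained:
  assumes "simple_graph G" "connected_graph G" "S \<subseteq> verts G"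
  obtains H where "subgraph H G" "connected_graph H" "S \<subseteq> verts H"
    "card (edges H) = steiner_distance G S"
proof -
  have "subgraph G G" using assms(1) by (simp add: subgraph_def)
  then have "\<exists>m H. subgraph H G \<and> connected_graph H \<and> S \<subseteq> verts H \<and> card (edges H) = m"
    using assms by blast
  from LeastI_ex[OF this] show thesis
    using that unfolding steiner_distance_def by blast
qed

lemma steiner_distance_mono:
  assumes "simple_graph G" "connected_graph G" "X \<subseteq> Y" "Y \<subseteq> verts G"
  shows "steiner_distance G X \<le> steiner_distance G Y"
proof -
  from steiner_distance_attained[OF assms(1,2,4)] obtain H where
    H: "subgraph H G" "connected_graph H" "Y \<subseteq> verts H" "card (edges H) = steiner_distance G Y" .
  then show ?thesis using assms(3) by (intro steiner_distance_le) auto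
qed

lemma steiner_distance_antimono_graph:
  assumes "subgraph T G" "connected_graph T" "X \<subseteq> verts T"
  shows "steiner_distance G X \<le> steiner_distance T X"
proof -
  have "simple_graph T" using assms(1) by (simp add: subgraph_def)
  from steiner_distance_attained[OF this assms(2,3)] obtain H where
    H: "subgraph H T" "connected_graph H" "X \<subseteq> verts H" "card (edges H) = steiner_distance T X" .
  have "subgraph H G" using H(1) assms(1) by (auto simp: subgraph_def)
  then show ?thesis using H by (intro steiner_distance_le) auto
qed

lemma connected_graph_union:
  assumes "connected_graph H" "connected_graph K" "verts H \<inter> verts K \<noteq> {}"
  shows "connected_graph \<lparr>verts = verts H \<union> verts K, edges = edges H \<union> edges K\<rparr>"
proof -
  let ?U = "{(x, y). {x, y} \<in> edges H \<union> edges K}\<^sup>*"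
  obtain z where z: "z \<in> verts H" "z \<in> verts K" using assms(3) by blast
  have H: "(u, v) \<in> ?U" if "u \<in> verts H" "v \<in> verts H" for u v
    using that assms(1) rtrancl_mono[of "{(x, y). {x, y} \<in> edges H}" "{(x, y). {x, y} \<in> edges H \<union> edges K}"]
    unfolding connected_graph_def by blast
  have K: "(u, v) \<in> ?U" if "u \<in> verts K" "v \<in> verts K" for u v
    using that assms(2) rtrancl_mono[of "{(x, y). {x, y} \<in> edges K}" "{(x, y). {x, y} \<in> edges H \<union> edges K}"]
    unfolding connected_graph_def by blast
  have "(u, z) \<in> ?U \<and> (z, u) \<in> ?U" if "u \<in> verts H \<union> verts K" for u
    using that H K z by blast
  then have "(u, v) \<in> ?U" if "u \<in> verts H \<union> verts K" "v \<in> verts H \<union> verts K" for u v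
    using that by (meson rtrancl_trans)
  then show ?thesis using z by (auto simp: connected_graph_def)
qed

text \<open>Optimal subgraphs for two sets that share a vertex unite to a connected subgraph.\<close>

lemma steiner_distance_union:
  assumes "simple_graph G" "connected_graph G" "X \<subseteq> verts G" "Y \<subseteq> verts G" "X \<inter> Y \<noteq> {}"
  shows "steiner_distance G (X \<union> Y) \<le> steiner_distance G X + steiner_distance G Y"
proof -
  from steiner_distance_attained[OF assms(1,2,3)] obtain H where
    H: "subgraph H G" "connected_graph H" "X \<subseteq> verts H" "card (edges H) = steiner_distance G X" .
  from steiner_distance_attained[OF assms(1,2,4)] obtain K where
    K: "subgraph K G" "connected_graph K" "Y \<subseteq> verts K" "card (edges K) = steiner_distance G Y" .
  let ?U = "\<lparr>verts = verts H \<union> verts K, edges = edges H \<union> edges K\<rparr>"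
  have "connected_graph ?U"
    using H K assms(5) by (intro connected_graph_union) auto
  moreover have "subgraph ?U G"
    using H(1) K(1) by (auto simp: subgraph_def simple_graph_def)
  moreover have "card (edges ?U) \<le> steiner_distance G X + steiner_distance G Y"
    using card_Un_le[of "edges H" "edges K"] H(4) K(4) by simp
  ultimately show ?thesis using H(3) K(3) by (intro steiner_distance_le) auto
qed

lemma steiner_distance_singleton:
  assumes "v \<in> verts G"
  shows "steiner_distance G {v} = 0"
proof -
  have "steiner_distance G {v} \<le> 0"
    using assms by (intro steiner_distance_le[of "\<lparr>verts = {v}, edges = {}\<rparr>"])
      (simp_all add: subgraph_def simple_graph_def connected_graph_def)
  then show ?thesis by simp
qed

lemma steiner_distance_edge:
  assumes "simple_graph G" "{u, v} \<in> edges G"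
  shows "steiner_distance G {u, v} \<le> 1"
proof (rule steiner_distance_le)
  let ?H = "\<lparr>verts = {u, v}, edges = {{u, v}}\<rparr>"
  show "subgraph ?H G" using assms by (auto simp: subgraph_def simple_graph_def)
  have "(u, v) \<in> {(x, y). {x, y} \<in> edges ?H}" "(v, u) \<in> {(x, y). {x, y} \<in> edges ?H}"
    by auto
  then show "connected_graph ?H"
    unfolding connected_graph_def by (auto intro: r_into_rtrancl)
qed auto

lemma steiner_distance_trans:
  assumes "simple_graph G" "connected_graph G" "{u, v, w} \<subseteq> verts G"
  shows "steiner_distance G {u, w} \<le> steiner_distance G {u, v} + steiner_distance G {v, w}"
proof -
  have "steiner_distance G {u, w} \<le> steiner_distance G ({u, v} \<union> {v, w})"
    using assms by (intro steiner_distance_mono) auto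
  also have "\<dots> \<le> steiner_distance G {u, v} + steiner_distance G {v, w}"
    using assms by (intro steiner_distance_union) auto
  finally show ?thesis .
qed

text \<open>Vertices are attached to \<open>X\<close> one at a time, each at cost at most \<open>d\<close>.\<close>

lemma steiner_distance_attach:
  assumes "simple_graph G" "connected_graph G" "X \<subseteq> verts G" "Y \<subseteq> verts G" "finite Y"
    and "\<And>v. v \<in> Y \<Longrightarrow> h v \<in> X \<and> steiner_distance G {v, h v} \<le> d"
  shows "steiner_distance G (X \<union> Y) \<le> steiner_distance G X + d * card Y"
  using assms(5,4,6)
proof (induction Y rule: finite_induct)
  case (insert v Y)
  have "steiner_distance G ((X \<union> Y) \<union> {v, h v})
      \<le> steiner_distance G (X \<union> Y) + steiner_distance G {v, h v}"
    using assms(1-3) insert.prems by (intro steiner_distance_union) auto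
  moreover have "(X \<union> Y) \<union> {v, h v} = X \<union> insert v Y" using insert.prems by auto
  moreover have "steiner_distance G (X \<union> Y) \<le> steiner_distance G X + d * card Y"
    using insert by auto
  moreover have "steiner_distance G {v, h v} \<le> d" using insert.prems by simp
  ultimately show ?case using insert.hyps by simp
qed simp

section \<open>Growing trees by leaves\<close>

text \<open>The intended use has \<open>W\<close> disjoint from the tree and \<open>q\<close> mapping \<open>W\<close> into it, so that each \<open>w\<close> becomes
  a leaf hanging at \<open>q w\<close>.\<close>

definition add_leaves :: "'a ugraph \<Rightarrow> 'a set \<Rightarrow> ('a \<Rightarrow> 'a) \<Rightarrow> 'a ugraph" where
  "add_leaves T W q = \<lparr>verts = verts T \<union> W, edges = edges T \<union> (\<lambda>w. {w, q w}) ` W\<rparr>"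

lemma connected_graph_add_leaves:
  assumes "connected_graph T" "q ` W \<subseteq> verts T"
  shows "connected_graph (add_leaves T W q)"
proof -
  let ?R = "{(x, y). {x, y} \<in> edges (add_leaves T W q)}"
  have T: "(u, v) \<in> ?R\<^sup>*" if "u \<in> verts T" "v \<in> verts T" for u v
    using that assms(1) rtrancl_mono[of "{(x, y). {x, y} \<in> edges T}" ?R]
    unfolding connected_graph_def add_leaves_def by auto
  have W: "(w, q w) \<in> ?R\<^sup>*" "(q w, w) \<in> ?R\<^sup>*" if "w \<in> W" for w
    using that by (auto simp: add_leaves_def insert_commute intro!: r_into_rtrancl)
  have near: "\<exists>z\<in>verts T. (u, z) \<in> ?R\<^sup>* \<and> (z, u) \<in> ?R\<^sup>*" if "u \<in> verts T \<union> W" for u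
  proof (cases "u \<in> W")
    case True
    then have "q u \<in> verts T" using assms(2) by blast
    with W[OF True] show ?thesis by blast
  qed (use that in blast)
  have "(u, v) \<in> ?R\<^sup>*" if u: "u \<in> verts T \<union> W" and v: "v \<in> verts T \<union> W" for u v
  proof -
    obtain x y where "x \<in> verts T" "(u, x) \<in> ?R\<^sup>*" "y \<in> verts T" "(y, v) \<in> ?R\<^sup>*"
      using near[OF u] near[OF v] by blast
    then show ?thesis using T[of x y] by (blast intro: rtrancl_trans)
  qed
  moreover have "verts (add_leaves T W q) = verts T \<union> W" by (simp add: add_leaves_def)
  ultimately show ?thesis using assms(1) by (auto simp: connected_graph_def)
qed

lemma simple_graph_add_leaves:
  assumes "simple_graph T" "finite W" "W \<inter> verts T = {}" "q ` W \<subseteq> verts T"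
  shows "simple_graph (add_leaves T W q)"
proof -
  have "card {w, q w} = 2" if "w \<in> W" for w
    using assms(3,4) that by (intro card_2_iff[THEN iffD2]) blast
  then show ?thesis using assms by (auto simp: simple_graph_def add_leaves_def)
qed

text \<open>A cycle through a new vertex \<open>w\<close> would need two different neighbours of \<open>w\<close>, but \<open>q w\<close> is the only
  one; a cycle avoiding all new vertices lies in the old tree.\<close>

lemma tree_add_leaves:
  assumes T: "tree T" and W: "finite W" "W \<inter> verts T = {}" "q ` W \<subseteq> verts T"
  shows "tree (add_leaves T W q)"
proof -
  let ?T = "add_leaves T W q"
  have only: "x = q w" if wx: "{w, x} \<in> edges ?T" "w \<in> W" for w x
  proof -
    have "w \<notin> verts T" using W(2) wx(2) by blast
    then have "{w, x} \<notin> edges T" using T by (auto simp: tree_def simple_graph_def)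
    then obtain w' where "w' \<in> W" "{w, x} = {w', q w'}" using wx(1) by (auto simp: add_leaves_def)
    then show ?thesis using W wx(2) by (auto simp: doubleton_eq_iff)
  qed
  have "False" if p: "is_cycle ?T p" for p
  proof -
    let ?l = "length p"
    have l: "?l \<ge> 3" and d: "distinct p"
      and e: "\<And>i. i < ?l \<Longrightarrow> {p ! i, p ! (Suc i mod ?l)} \<in> edges ?T"
      using p by (auto simp: is_cycle_def)
    have notW: "p ! i \<notin> W" if i: "i < ?l" for i
    proof
      assume w: "p ! i \<in> W"
      \<comment> \<open>the cyclic predecessor of \<open>i\<close>; it differs from the successor because \<open>?l \<ge> 3\<close>\<close>
      define j where "j = (if i = 0 then ?l - 1 else i - 1)"
      have j: "j < ?l" "Suc j mod ?l = i" using i l by (auto simp: j_def)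
      have "p ! (Suc i mod ?l) = q (p ! i)" using only[OF e[OF i] w] .
      moreover have "p ! j = q (p ! i)"
        using e[OF j(1)] j(2) only[of "p ! i" "p ! j"] w by (simp add: insert_commute)
      ultimately have "p ! j = p ! (Suc i mod ?l)" by simp
      moreover have "Suc i mod ?l < ?l" using l by (intro mod_less_divisor) linarith
      ultimately have "j = Suc i mod ?l"
        using d j(1) by (simp add: nth_eq_iff_index_eq)
      then show False using l i by (cases "Suc i = ?l") (auto simp: j_def split: if_splits)
    qed
    have "{p ! i, p ! (Suc i mod ?l)} \<in> edges T" if i: "i < ?l" for i
    proof -
      have "Suc i mod ?l < ?l" using l by (intro mod_less_divisor) linarith
      then have "w \<notin> {p ! i, p ! (Suc i mod ?l)}" if "w \<in> W" for w
        using notW i that by blast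
      then have "{p ! i, p ! (Suc i mod ?l)} \<noteq> {w, q w}" if "w \<in> W" for w
        using that by (metis insertI1)
      then have "{p ! i, p ! (Suc i mod ?l)} \<notin> (\<lambda>w. {w, q w}) ` W" by (simp add: image_iff)
      then show ?thesis using e[OF i] by (simp add: add_leaves_def)
    qed
    then have "is_cycle T p" using l d by (simp add: is_cycle_def)
    with T show False by (auto simp: tree_def)
  qed
  then show ?thesis
    using T W connected_graph_add_leaves[of T q W] simple_graph_add_leaves[of T W q]
    by (auto simp: tree_def)
qed

lemma subgraph_add_leaves:
  assumes "tree T" "finite W" "W \<inter> verts T = {}" "q ` W \<subseteq> verts T"
  shows "subgraph T (add_leaves T W q)"
  using assms by (auto simp: subgraph_def tree_def add_leaves_def)

lemma add_leaves_subgraph: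
  assumes "subgraph T G" "finite W" "W \<inter> verts T = {}" "q ` W \<subseteq> verts T"
    "W \<subseteq> verts G" "\<And>w. w \<in> W \<Longrightarrow> {w, q w} \<in> edges G"
  shows "subgraph (add_leaves T W q) G"
  using assms simple_graph_add_leaves[of T W q] by (auto simp: subgraph_def add_leaves_def)

section \<open>Edge cuts of a weighted rooted tree\<close>

text \<open>A rooted tree on the clusters \<open>0, \<dots>, m\<close> is given by its parent function. The truncated subtraction
  makes the one inequality say both that \<open>0\<close> is its own parent and that parents of other clusters come
  earlier. The elements of \<open>V\<close> are distributed over the clusters by \<open>c\<close>, and the edge from \<open>j\<close> to
  its parent is named by \<open>j\<close>, for \<open>1 \<le> j \<le> m\<close>.\<close>

locale weighted_tree =
  fixes par :: "nat \<Rightarrow> nat" and m C :: nat and V :: "'a set" and c :: "'a \<Rightarrow> nat"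
  assumes par_le: "par j \<le> j - 1"
    and finite_V: "finite V"
    and c_le: "v \<in> V \<Longrightarrow> c v \<le> m"
    and weight: "j \<le> m \<Longrightarrow> C \<le> card {v \<in> V. c v = j}"
begin

definition anc :: "nat \<Rightarrow> nat \<Rightarrow> bool" where
  "anc i j \<longleftrightarrow> (\<exists>t. (par ^^ t) j = i)"

text \<open>One of the two sides into which the edge \<open>j\<close> splits \<open>V\<close>.\<close>

definition below :: "nat \<Rightarrow> 'a set" where
  "below j = {v \<in> V. anc j (c v)}"

lemma anc_refl: "anc i i"
  unfolding anc_def by (rule exI[of _ 0]) simp

lemma anc_par: "anc (par i) i"
  unfolding anc_def by (rule exI[of _ 1]) simp

lemma anc_trans: "anc i j \<Longrightarrow> anc j l \<Longrightarrow> anc i l"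
  unfolding anc_def by (metis funpow_add o_apply)

lemma anc_le: "anc i j \<Longrightarrow> i \<le> j"
proof -
  have "(par ^^ t) j \<le> j" for t
    by (induction t) (use par_le in \<open>auto intro: order.trans[OF _ order.trans[OF par_le]]\<close>)
  then show "anc i j \<Longrightarrow> i \<le> j" by (auto simp: anc_def)
qed

lemma anc_0: "anc 0 j"
proof (induction j rule: less_induct)
  case (less j)
  show ?case
  proof (cases "j = 0")
    case False
    then have "par j < j" using par_le[of j] by simp
    then show ?thesis using less anc_par anc_trans by blast
  qed (simp add: anc_refl)
qed

lemma anc_linear: "anc i l \<Longrightarrow> anc j l \<Longrightarrow> anc i j \<or> anc j i"
proof -
  have *: "anc ((par ^^ t) l) ((par ^^ s) l)" if "s \<le> t" for s t
    using that unfolding anc_def by (metis funpow_add le_add_diff_inverse2 o_apply)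
  assume "anc i l" "anc j l"
  then show ?thesis using * unfolding anc_def[of _ l] by (metis nat_le_linear)
qed

lemma anc_proper: "anc i j \<Longrightarrow> i \<noteq> j \<Longrightarrow> anc i (par j)"
  unfolding anc_def by (metis funpow_0 funpow_Suc_right not0_implies_Suc o_apply)

lemma below_mono: "anc i j \<Longrightarrow> below j \<subseteq> below i"
  using anc_trans by (auto simp: below_def)

lemma finite_below: "finite (below j)"
  using finite_V by (simp add: below_def)

lemma card_disjoint_classes:
  assumes "X \<subseteq> V" "Y \<subseteq> V" "X \<inter> Y = {}" "L \<subseteq> {..m}"
    and "\<And>v. v \<in> V \<Longrightarrow> c v \<in> L \<Longrightarrow> v \<notin> X \<and> v \<notin> Y"
  shows "card X + card Y + card L * C \<le> card V"
proof -
  let ?F = "\<lambda>j. {v \<in> V. c v = j}"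
  have fin: "finite X" "finite Y" "finite L"
    using assms finite_V finite_subset by blast+
  have "card L * C \<le> (\<Sum>j\<in>L. card (?F j))"
    using weight assms(4) by (intro sum_bounded_below[of L C, simplified]) auto
  also have "\<dots> = card (\<Union>j\<in>L. ?F j)"
    using fin finite_V by (intro card_UN_disjoint[symmetric]) auto
  finally have "card X + card Y + card L * C \<le> card (X \<union> Y) + card (\<Union>j\<in>L. ?F j)"
    using assms(3) fin by (simp add: card_Un_disjoint)
  also have "\<dots> = card ((X \<union> Y) \<union> (\<Union>j\<in>L. ?F j))"
    using fin finite_V assms(5) by (intro card_Un_disjoint[symmetric]) auto
  also have "\<dots> \<le> card V"
    using assms(1,2) finite_V by (intro card_mono) auto
  finally show ?thesis .
qed

text \<open>Let \<open>j\<close> be a deepest edge with both sides of size at least \<open>t\<close>. If all other such edges lie above \<open>j\<close>,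
  they form a chain, and the two end pieces are the side below \<open>j\<close> and the side above the topmost of
  them; each edge of the chain except \<open>j\<close> brings its own lower cluster, located between the end
  pieces. Otherwise let \<open>i\<close> be a deepest one among those not above \<open>j\<close>; the sides below \<open>i\<close> and below \<open>j\<close>
  are disjoint end pieces, and outside them lie the root cluster and the lower clusters of the edges
  other than \<open>i\<close> and \<open>j\<close>. Both times there are \<open>card (M t) - 1\<close> clusters besides the end pieces.\<close>

lemma balanced_cuts:
  defines "M t \<equiv> {j \<in> {1..m}. t \<le> card (below j) \<and> t \<le> card V - card (below j)}"
  assumes ne: "M t \<noteq> {}"
  shows "2 * t + (card (M t) - 1) * C \<le> card V"
proof -
  let ?M = "M t"
  have fin: "finite ?M" by (simp add: M_def)
  \<comment> \<open>descendants have larger numbers, so nothing in \<open>?M\<close> lies below \<open>j\<close>\<close>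
  define j where "j = Max ?M"
  have j: "j \<in> ?M" and jmax: "\<And>l. l \<in> ?M \<Longrightarrow> l \<le> j"
    using fin ne by (auto simp: j_def)
  have bV: "below l \<subseteq> V" for l by (auto simp: below_def)
  have pos: "l \<in> ?M \<Longrightarrow> 0 < l" for l by (auto simp: M_def)
  have big: "t \<le> card (below l)" "t \<le> card (V - below l)" if "l \<in> ?M" for l
    using that bV finite_below by (auto simp: M_def card_Diff_subset)
  show ?thesis
  proof (cases "\<forall>l\<in>?M. anc l j")
    case True
    define r where "r = Min ?M"
    have r: "r \<in> ?M" and rmin: "\<And>l. l \<in> ?M \<Longrightarrow> r \<le> l"
      using fin ne by (auto simp: r_def)
    have ranc: "anc r l" if "l \<in> ?M" for l
      using anc_linear[of r j l] True r that anc_le rmin anc_refl by (metis order.antisym)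
    have "card (below j) + card (V - below r) + card (?M - {j}) * C \<le> card V"
    proof (rule card_disjoint_classes)
      show "below j \<inter> (V - below r) = {}" using ranc[OF j] below_mono by blast
      fix v assume v: "v \<in> V" "c v \<in> ?M - {j}"
      have "v \<notin> below j" using v jmax anc_le by (auto simp: below_def dest: order.antisym)
      moreover have "v \<in> below r" using v ranc by (auto simp: below_def)
      ultimately show "v \<notin> below j \<and> v \<notin> V - below r" by simp
    qed (use bV in \<open>auto simp: M_def\<close>)
    then show ?thesis using big(1)[OF j] big(2)[OF r] j fin by (simp add: card_Diff_singleton)
  next
    case False
    let ?I = "{l \<in> ?M. \<not> anc l j}"
    define i where "i = Max ?I"
    have i: "i \<in> ?I" unfolding i_def using fin False by (intro Max_in) auto
    have imax: "\<And>l. l \<in> ?I \<Longrightarrow> l \<le> i" using fin by (auto simp: i_def)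
    have ij: "\<not> anc j i" using i jmax anc_le anc_refl by (metis (lifting) mem_Collect_eq order.antisym)
    have ne': "i \<noteq> j" using i anc_refl by auto
    have "card (below j) + card (below i) + card (insert 0 (?M - {i, j})) * C \<le> card V"
    proof (rule card_disjoint_classes)
      show "below j \<inter> below i = {}" using anc_linear i ij by (auto simp: below_def)
      fix v assume v: "v \<in> V" "c v \<in> insert 0 (?M - {i, j})"
      have "\<not> anc j (c v)"
        using v jmax anc_le pos j by (metis DiffE bot_nat_0.extremum_uniqueI insertCI insertE less_not_refl order.antisym)
      moreover have "\<not> anc i (c v)"
      proof
        assume a: "anc i (c v)"
        then have "c v \<in> ?M - {i, j}" using v pos i anc_le by fastforce
        then show False
          using imax[of "c v"] anc_le[OF a] anc_trans[OF a] i by fastforce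
      qed
      ultimately show "v \<notin> below j \<and> v \<notin> below i" by (simp add: below_def)
    qed (use bV in \<open>auto simp: M_def\<close>)
    moreover have "card (insert 0 (?M - {i, j})) = card ?M - 1"
    proof -
      have "{i, j} \<subseteq> ?M" using i j by auto
      then have "card (?M - {i, j}) = card ?M - 2" "2 \<le> card ?M"
        using ne' fin card_mono[of ?M "{i, j}"] by (auto simp: card_Diff_subset)
      moreover have "0 \<notin> ?M" using pos by auto
      ultimately show ?thesis using fin by (simp add: card_insert_if)
    qed
    ultimately show ?thesis using big(1)[OF j] big(1)[of i] i by simp
  qed
qed

definition cuts :: "'a set \<Rightarrow> nat set" where
  "cuts S = {j \<in> {1..m}. S \<inter> below j \<noteq> {} \<and> \<not> S \<subseteq> below j}"

text \<open>The edges separating \<open>S\<close>, each identified with its lower end, form a subtree once the top \<open>r\<close> is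
  added, and this subtree contains all clusters met by \<open>S\<close>. The top is the lowest common ancestor of
  these clusters.\<close>

lemma cuts_closed:
  assumes "S \<subseteq> V" "S \<noteq> {}"
  obtains r where "r \<le> m" "\<And>j. j \<in> cuts S \<Longrightarrow> par j \<in> insert r (cuts S)"
    "\<And>s. s \<in> S \<Longrightarrow> c s \<in> insert r (cuts S)"
proof -
  let ?R = "{j. j \<le> m \<and> S \<subseteq> below j}"
  \<comment> \<open>the clusters above all of \<open>S\<close> form a chain, whose lowest member has the largest number\<close>
  define r where "r = Max ?R"
  have "0 \<in> ?R" using assms anc_0 by (auto simp: below_def)
  then have "r \<in> ?R" unfolding r_def by (intro Max_in) auto
  then have r: "r \<le> m" "S \<subseteq> below r" by auto
  have rmax: "l \<le> r" if "l \<le> m" "S \<subseteq> below l" for l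
    unfolding r_def using that by (intro Max_ge) auto
  have deepest: "l = r" if l: "l \<le> m" "S \<subseteq> below l" and "anc r l" for l
    using rmax[OF l] anc_le[OF \<open>anc r l\<close>] by simp
  have pos: "l \<in> insert r (cuts S)" if "anc r l" "l \<le> m" "S \<inter> below l \<noteq> {}" for l
  proof (cases "S \<subseteq> below l")
    case True
    then show ?thesis using deepest that by blast
  next
    case False
    have "l \<noteq> 0"
      using False assms anc_0 by (auto simp: below_def)
    then show ?thesis using False that by (auto simp: cuts_def)
  qed
  have "par j \<in> insert r (cuts S)" if j: "j \<in> cuts S" for j
  proof (rule pos)
    obtain s where s: "s \<in> S" "s \<in> below j" using j by (auto simp: cuts_def)
    have "anc r j \<or> anc j r" using s r anc_linear by (auto simp: below_def)
    moreover have "\<not> anc j r" using below_mono[of j r] r(2) j by (auto simp: cuts_def)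
    ultimately show "anc r (par j)" using anc_proper anc_refl by metis
    show "par j \<le> m" using j par_le[of j] by (auto simp: cuts_def)
    show "S \<inter> below (par j) \<noteq> {}" using s below_mono[OF anc_par] by blast
  qed
  moreover have "c s \<in> insert r (cuts S)" if "s \<in> S" for s
    using that r(2) assms(1) c_le anc_refl by (intro pos) (auto simp: below_def)
  ultimately show thesis using that r(1) by blast
qed

end

section \<open>Counting separated sets\<close>

text \<open>The number of \<open>k\<close>-subsets of an \<open>N\<close>-set that meet both a given \<open>a\<close>-subset and its complement, see
  \<open>card_separated\<close>.\<close>

definition separated_count :: "nat \<Rightarrow> nat \<Rightarrow> nat \<Rightarrow> real" where
  "separated_count N k a = real (N choose k) - real (a choose k) - real ((N - a) choose k)"

text \<open>The increment of \<open>separated_count\<close> from \<open>t - 1\<close> to \<open>t\<close>, see \<open>separated_count_sum_low\<close>.\<close>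

definition separated_step :: "nat \<Rightarrow> nat \<Rightarrow> nat \<Rightarrow> real" where
  "separated_step N k t = real ((N - t) choose (k - 1)) - real ((t - 1) choose (k - 1))"

lemma card_separated:
  assumes "finite V" "B \<subseteq> V" "k > 0"
  shows "real (card {S. S \<subseteq> V \<and> card S = k \<and> S \<inter> B \<noteq> {} \<and> \<not> S \<subseteq> B})
    = separated_count (card V) k (card B)"
proof -
  let ?P = "\<lambda>X. {S. S \<subseteq> X \<and> card S = k}"
  have fB: "finite B" using assms finite_subset by blast
  have fin: "finite (?P X)" if "finite X" for X using that by simp
  let ?L = "?P B \<union> ?P (V - B)"
  have eq: "{S. S \<subseteq> V \<and> card S = k \<and> S \<inter> B \<noteq> {} \<and> \<not> S \<subseteq> B} = ?P V - ?L"
    using assms by blast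
  have sub: "?L \<subseteq> ?P V" using assms(2) by blast
  have disj: "?P B \<inter> ?P (V - B) = {}"
  proof (rule equals0I)
    fix S assume "S \<in> ?P B \<inter> ?P (V - B)"
    then have "S = {}" "card S = k" by blast+
    then show False using assms(3) by simp
  qed
  have "card ?L = (card B choose k) + ((card V - card B) choose k)"
    using assms fB disj fin[OF fB] fin[of "V - B"]
    by (simp add: card_Un_disjoint n_subsets card_Diff_subset)
  moreover have "card (?P V) = card V choose k" using assms(1) by (simp add: n_subsets)
  moreover have "card (?P V - ?L) = card (?P V) - card ?L"
    using finite_subset[OF sub fin[OF assms(1)]] sub by (rule card_Diff_subset)
  moreover have "card ?L \<le> card (?P V)" using sub fin[OF assms(1)] by (rule card_mono[rotated])
  ultimately show ?thesis unfolding eq separated_count_def by linarith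
qed

lemma separated_step_nonneg: "t \<le> N div 2 \<Longrightarrow> separated_step N k t \<ge> 0"
  unfolding separated_step_def by (simp add: binomial_right_mono)

lemma separated_count_sum_low:
  assumes "k > 0" "a \<le> N"
  shows "separated_count N k a = (\<Sum>t=1..a. separated_step N k t)"
  using assms(2)
proof (induction a)
  case (Suc a)
  obtain k' where k: "k = Suc k'" using assms(1) by (cases k) auto
  have "N - a = Suc (N - Suc a)" using Suc.prems by simp
  then have "(N - a) choose k = ((N - Suc a) choose k') + ((N - Suc a) choose k)"
    by (simp add: k)
  then have "separated_count N k (Suc a) = separated_count N k a + separated_step N k (Suc a)"
    by (simp add: separated_count_def separated_step_def k)
  then show ?case using Suc by simp
qed (use assms in \<open>simp add: separated_count_def\<close>)

text \<open>By symmetry the value depends on the smaller part only, and it is the sum of the increments up to the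
  size of that part. Written with a condition symmetric in the two parts, this reduces sums of
  \<open>separated_count\<close> to counting balanced splits (\<open>sum_separated_count\<close>).\<close>

lemma separated_count_layers:
  assumes "k > 0" "a \<le> N"
  shows "separated_count N k a
    = (\<Sum>t | t \<in> {1..N div 2} \<and> t \<le> a \<and> t \<le> N - a. separated_step N k t)"
proof (cases "a \<le> N - a")
  case True
  then have "{t. t \<in> {1..N div 2} \<and> t \<le> a \<and> t \<le> N - a} = {1..a}" by auto
  then show ?thesis using assms separated_count_sum_low by simp
next
  case False
  then have "{t. t \<in> {1..N div 2} \<and> t \<le> a \<and> t \<le> N - a} = {1..N - a}" by auto
  moreover have "separated_count N k a = separated_count N k (N - a)"
    using assms by (simp add: separated_count_def)
  ultimately show ?thesis using assms separated_count_sum_low[of k "N - a"] by simp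
qed

lemma sum_separated_count:
  assumes "k > 0" "finite J" "\<And>j. j \<in> J \<Longrightarrow> a j \<le> N"
  shows "(\<Sum>j\<in>J. separated_count N k (a j))
    = (\<Sum>t=1..N div 2. separated_step N k t * real (card {j \<in> J. t \<le> a j \<and> t \<le> N - a j}))"
proof -
  have "(\<Sum>j\<in>J. separated_count N k (a j))
      = (\<Sum>j\<in>J. \<Sum>t | t \<in> {1..N div 2} \<and> t \<le> a j \<and> t \<le> N - a j. separated_step N k t)"
    using assms by (intro sum.cong separated_count_layers) auto
  also have "\<dots> = (\<Sum>t=1..N div 2. \<Sum>j | j \<in> J \<and> t \<le> a j \<and> t \<le> N - a j. separated_step N k t)"
    using assms(2) by (intro sum.swap_restrict) auto
  finally show ?thesis by (simp add: mult.commute)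
qed

text \<open>The hockey-stick identity evaluates the sums of the last two terms of \<open>separated_count\<close>.\<close>

lemma path_total:
  assumes "k > 0"
  shows "(\<Sum>i\<le>N. separated_count N k i) = (real k - 1) / (real k + 1) * (real N + 1) * real (N choose k)"
proof -
  have "(\<Sum>i\<le>N. real (i choose k)) = real (Suc N choose Suc k)"
    by (metis of_nat_sum sum_choose_upper)
  moreover have "(\<Sum>i\<le>N. real ((N - i) choose k)) = (\<Sum>i\<le>N. real (i choose k))"
    by (rule sum.reindex_bij_witness[of _ "\<lambda>i. N - i" "\<lambda>i. N - i"]) auto
  ultimately have sum: "(\<Sum>i\<le>N. separated_count N k i)
      = (real N + 1) * real (N choose k) - 2 * real (Suc N choose Suc k)"
    by (simp add: separated_count_def sum_subtractf add.commute del: binomial_Suc_Suc)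
  have "real (Suc k * (Suc N choose Suc k)) = real (Suc N * (N choose k))"
    by (simp only: Suc_times_binomial)
  then have "(real k + 1) * real (Suc N choose Suc k) = (real N + 1) * real (N choose k)"
    by (simp only: of_nat_mult of_nat_Suc add.commute)
  then have "real (Suc N choose Suc k) = (real N + 1) * real (N choose k) / (real k + 1)"
    by (simp add: eq_divide_eq mult.commute del: binomial_Suc_Suc)
  then show ?thesis unfolding sum by (simp only:) (simp add: divide_simps, simp add: algebra_simps)
qed

context weighted_tree
begin

text \<open>Both this sum and the one over all splits \<open>i \<le> card V\<close> are decomposed into layers. In layer \<open>t\<close>, \<open>C\<close>
  times the number of balanced edges exceeds the number \<open>card V - 2 * t + 1\<close> of balanced splits by at
  most \<open>C - 1\<close>. The excesses add up to \<open>C - 1\<close> times the value of \<open>separated_count\<close> at the middle split.\<close>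

lemma total_cuts:
  assumes "k > 0" "C > 0"
  shows "real C * (\<Sum>j=1..m. separated_count (card V) k (card (below j)))
    \<le> (real k - 1) / (real k + 1) * (real (card V) + 1) * real (card V choose k)
      + (real C - 1) * real (card V choose k)"
proof -
  let ?N = "card V"
  let ?h = "?N div 2"
  let ?d = "separated_step ?N k"
  have below: "card (below j) \<le> ?N" for j
    using finite_V by (intro card_mono) (auto simp: below_def)
  have "real C * (\<Sum>j=1..m. separated_count ?N k (card (below j)))
      = (\<Sum>t=1..?h. ?d t * (real C * real (card {j \<in> {1..m}. t \<le> card (below j) \<and> t \<le> ?N - card (below j)})))"
    using assms below by (subst sum_separated_count) (auto simp: sum_distrib_left ac_simps)
  also have "\<dots> \<le> (\<Sum>t=1..?h. ?d t * (real (card {i \<in> {..?N}. t \<le> i \<and> t \<le> ?N - i}) + (real C - 1)))"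
  proof (intro sum_mono mult_left_mono separated_step_nonneg)
    fix t assume t: "t \<in> {1..?h}"
    let ?M = "{j \<in> {1..m}. t \<le> card (below j) \<and> t \<le> ?N - card (below j)}"
    have window: "{i \<in> {..?N}. t \<le> i \<and> t \<le> ?N - i} = {t..?N - t}" using t by auto
    have "2 * t \<le> ?N" using t by (simp add: less_eq_div_iff_mult_less_eq)
    then have 1: "card {i \<in> {..?N}. t \<le> i \<and> t \<le> ?N - i} = ?N - 2 * t + 1"
      unfolding window card_atLeastAtMost by linarith
    have "C * card ?M \<le> ?N - 2 * t + C"
    proof (cases "?M = {}")
      case False
      then have "card ?M \<noteq> 0" by (subst card_0_eq) auto
      then obtain x where x: "card ?M = Suc x" using not0_implies_Suc by blast
      show ?thesis using balanced_cuts[OF False] unfolding x by (simp add: algebra_simps)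
    next
      case True
      show ?thesis unfolding True by simp
    qed
    then have "real (C * card ?M) \<le> real (?N - 2 * t + C)" by (rule of_nat_mono)
    then show "real C * real (card ?M) \<le> real (card {i \<in> {..?N}. t \<le> i \<and> t \<le> ?N - i}) + (real C - 1)"
      unfolding 1 by simp
  qed auto
  also have "\<dots> = (\<Sum>i\<le>?N. separated_count ?N k i) + (real C - 1) * (\<Sum>t=1..?h. ?d t)"
    using assms by (subst sum_separated_count)
      (auto simp: algebra_simps sum.distrib sum_distrib_left sum_subtractf)
  also have "(\<Sum>t=1..?h. ?d t) = separated_count ?N k ?h"
    using assms by (subst separated_count_sum_low) auto
  also have "(real C - 1) * separated_count ?N k ?h \<le> (real C - 1) * real (?N choose k)"
    using assms by (intro mult_left_mono) (auto simp: separated_count_def)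
  finally show ?thesis using path_total[OF assms(1), of ?N] by simp
qed

lemma sum_card_cuts:
  assumes "k > 0"
  shows "real (\<Sum>S | S \<subseteq> V \<and> card S = k. card (cuts S))
    = (\<Sum>j=1..m. separated_count (card V) k (card (below j)))"
proof -
  have fin: "finite {S. S \<subseteq> V \<and> card S = k}" using finite_V by simp
  have "(\<Sum>S | S \<subseteq> V \<and> card S = k. card (cuts S))
      = (\<Sum>S | S \<subseteq> V \<and> card S = k. \<Sum>j | j \<in> {1..m} \<and> (S \<inter> below j \<noteq> {} \<and> \<not> S \<subseteq> below j). 1)"
    by (simp add: cuts_def)
  also have "\<dots> = (\<Sum>j=1..m. \<Sum>S | S \<in> {S. S \<subseteq> V \<and> card S = k} \<and> (S \<inter> below j \<noteq> {} \<and> \<not> S \<subseteq> below j). 1)"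
    using fin by (intro sum.swap_restrict) auto
  also have "\<dots> = (\<Sum>j=1..m. card {S. S \<subseteq> V \<and> card S = k \<and> S \<inter> below j \<noteq> {} \<and> \<not> S \<subseteq> below j})"
    by (simp add: conj_assoc)
  also have "real \<dots> = (\<Sum>j=1..m. separated_count (card V) k (card (below j)))"
    using finite_V assms by (simp add: card_separated below_def)
  finally show ?thesis .
qed

text \<open>The last edge of \<open>E\<close> is a leaf of the subtree formed by \<open>E\<close> and \<open>r\<close>: no other member has it as
  parent, since parents come earlier. So the centres can be joined one at a time in increasing order.\<close>

lemma steiner_distance_skeleton:
  assumes T: "simple_graph T" "connected_graph T" and a: "\<And>j. j \<le> m \<Longrightarrow> a j \<in> verts T"
    and link: "\<And>j. j \<in> {1..m} \<Longrightarrow> steiner_distance T {a j, a (par j)} \<le> L"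
    and E: "finite E" "E \<subseteq> {1..m}" "\<And>j. j \<in> E \<Longrightarrow> par j \<in> insert r E" and r: "r \<le> m"
  shows "steiner_distance T (a ` insert r E) \<le> L * card E"
  using E
proof (induction E rule: finite_linorder_max_induct)
  case empty
  then show ?case using steiner_distance_singleton[of "a r" T] a[OF r] by simp
next
  case (insert b E)
  have closed: "par j \<in> insert r E" if "j \<in> insert b E" for j
  proof -
    have "j \<ge> 1" "j \<le> b" using that insert.prems insert.hyps by force+
    then have "par j \<noteq> b" using par_le[of j] by linarith
    then show ?thesis using insert.prems(2)[OF that] by auto
  qed
  have "steiner_distance T (a ` insert r E) \<le> L * card E"
    using insert closed by auto
  moreover have "steiner_distance T (a ` insert r E \<union> {a b, a (par b)})
      \<le> steiner_distance T (a ` insert r E) + steiner_distance T {a b, a (par b)}"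
  proof (rule steiner_distance_union[OF T])
    have "insert r E \<subseteq> {..m}" "b \<le> m" using r insert.prems by auto
    moreover have "par b \<le> m" using par_le[of b] \<open>b \<le> m\<close> by simp
    ultimately show "a ` insert r E \<subseteq> verts T" "{a b, a (par b)} \<subseteq> verts T"
      using a by auto
    show "a ` insert r E \<inter> {a b, a (par b)} \<noteq> {}" using closed[of b] by blast
  qed
  moreover have "a ` insert r E \<union> {a b, a (par b)} = a ` insert r (insert b E)"
    using closed[of b] by auto
  moreover have "steiner_distance T {a b, a (par b)} \<le> L" using insert.prems by (intro link) auto
  moreover have "b \<notin> E" using insert.hyps by auto
  ultimately show ?case using insert.hyps by simp
qed

text \<open>The skeleton of the separating edges passes through the centres of all clusters met by \<open>S\<close>, so each
  element of \<open>S\<close> can be attached to it through its own centre.\<close>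

lemma steiner_distance_via_cuts:
  assumes T: "simple_graph T" "connected_graph T" "verts T = V"
    and a: "\<And>j. j \<le> m \<Longrightarrow> a j \<in> verts T"
    and link: "\<And>j. j \<in> {1..m} \<Longrightarrow> steiner_distance T {a j, a (par j)} \<le> L"
    and near: "\<And>v. v \<in> V \<Longrightarrow> steiner_distance T {v, a (c v)} \<le> d"
    and S: "S \<subseteq> V" "S \<noteq> {}"
  shows "steiner_distance T S \<le> L * card (cuts S) + d * card S"
proof -
  obtain r where r: "r \<le> m" "\<And>j. j \<in> cuts S \<Longrightarrow> par j \<in> insert r (cuts S)"
    "\<And>s. s \<in> S \<Longrightarrow> c s \<in> insert r (cuts S)" using cuts_closed[OF S] by metis
  let ?X = "a ` insert r (cuts S)"
  have sub: "cuts S \<subseteq> {1..m}" by (auto simp: cuts_def)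
  have X: "?X \<subseteq> verts T" using r(1) sub a by force
  have "steiner_distance T S \<le> steiner_distance T (?X \<union> S)"
    using T S X by (intro steiner_distance_mono) auto
  also have "\<dots> \<le> steiner_distance T ?X + d * card S"
  proof (rule steiner_distance_attach[OF T(1,2) X])
    show "S \<subseteq> verts T" "finite S" using S T(3) finite_V finite_subset by auto
    show "a (c v) \<in> ?X \<and> steiner_distance T {v, a (c v)} \<le> d" if "v \<in> S" for v
      using r(3)[OF that] near S that by blast
  qed
  also have "steiner_distance T ?X \<le> L * card (cuts S)"
    using T(1,2) a link r sub finite_subset[OF sub] by (intro steiner_distance_skeleton) auto
  finally show ?thesis by simp
qed

lemma steiner_wiener_le:
  assumes T: "simple_graph T" "connected_graph T" "verts T = V"
    and a: "\<And>j. j \<le> m \<Longrightarrow> a j \<in> verts T"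
    and link: "\<And>j. j \<in> {1..m} \<Longrightarrow> steiner_distance T {a j, a (par j)} \<le> L"
    and near: "\<And>v. v \<in> V \<Longrightarrow> steiner_distance T {v, a (c v)} \<le> d"
    and k: "k > 0" and C: "C > 0"
  shows "real (steiner_wiener k T) \<le>
    ((real k - 1) / (real k + 1) * (real L * (real (card V) + 1) / real C)
      + (real L * (real C - 1) / real C + real d * real k)) * real (card V choose k)"
proof -
  let ?B = "real (card V choose k)"
  define q where "q = (real k - 1) / (real k + 1)"
  let ?p = "q * (real (card V) + 1)"
  have "steiner_wiener k T \<le> (\<Sum>S | S \<subseteq> V \<and> card S = k. L * card (cuts S) + d * k)"
    unfolding steiner_wiener_def T(3)
  proof (rule sum_mono)
    fix S assume S: "S \<in> {S. S \<subseteq> V \<and> card S = k}"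
    then have "S \<noteq> {}" using k by auto
    then show "steiner_distance T S \<le> L * card (cuts S) + d * k"
      using steiner_distance_via_cuts[OF T a link near, of S] S by auto
  qed
  also have "\<dots> = L * (\<Sum>S | S \<subseteq> V \<and> card S = k. card (cuts S)) + d * k * (card V choose k)"
    using finite_V by (simp add: sum.distrib sum_distrib_left n_subsets)
  finally have "real (steiner_wiener k T) \<le>
      real (L * (\<Sum>S | S \<subseteq> V \<and> card S = k. card (cuts S)) + d * k * (card V choose k))"
    by (rule of_nat_mono)
  also have "\<dots> = real L * (\<Sum>j=1..m. separated_count (card V) k (card (below j))) + real d * real k * ?B"
    using sum_card_cuts[OF k] by simp
  also have "(\<Sum>j=1..m. separated_count (card V) k (card (below j))) \<le> (?p * ?B + (real C - 1) * ?B) / real C"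
    using total_cuts[OF k C] C unfolding q_def by (subst pos_le_divide_eq) (simp_all add: mult.commute)
  finally have "real (steiner_wiener k T) \<le>
      real L * ((?p * ?B + (real C - 1) * ?B) / real C) + real d * real k * ?B"
    by (simp add: mult_left_mono)
  also have "\<dots> = (q * (real L * (real (card V) + 1) / real C)
      + (real L * (real C - 1) / real C + real d * real k)) * ?B"
    using C by (simp add: field_simps)
  finally show ?thesis unfolding q_def .
qed

end

section \<open>Packing closed neighbourhoods\<close>

definition nbhd :: "'a ugraph \<Rightarrow> 'a \<Rightarrow> 'a set" where
  "nbhd G v = {u. {u, v} \<in> edges G}"

lemma nbhd_simple:
  assumes "simple_graph G"
  shows "nbhd G v \<subseteq> verts G" "v \<notin> nbhd G v" "finite (nbhd G v)"
proof -
  show "nbhd G v \<subseteq> verts G" "v \<notin> nbhd G v"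
    using assms by (auto simp: nbhd_def simple_graph_def)
  then show "finite (nbhd G v)" using assms finite_subset by (auto simp: simple_graph_def)
qed

lemma card_nbhd:
  assumes "simple_graph G"
  shows "card (nbhd G v) = degree G v"
proof -
  have "{e \<in> edges G. v \<in> e} = (\<lambda>u. {u, v}) ` nbhd G v"
  proof -
    have "\<exists>u. e = {u, v}" if "e \<in> edges G" "v \<in> e" for e
      using assms that by (auto simp: simple_graph_def card_2_iff)
    then show ?thesis by (auto simp: nbhd_def)
  qed
  moreover have "inj_on (\<lambda>u. {u, v}) (nbhd G v)" by (auto simp: inj_on_def doubleton_eq_iff)
  ultimately show ?thesis by (simp add: degree_def card_image)
qed

lemma min_degree_less_card_closed_nbhd:
  assumes "simple_graph G" "v \<in> verts G"
  shows "Suc (min_degree G) \<le> card (insert v (nbhd G v))"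
proof -
  have "min_degree G \<le> degree G v"
    using assms by (auto simp: min_degree_def simple_graph_def)
  then show ?thesis using card_nbhd[OF assms(1), of v] nbhd_simple[OF assms(1), of v] by simp
qed

text \<open>The tree \<open>T\<close> is covered by \<open>m + 1\<close> clusters of radius \<open>d\<close> around the centres \<open>a 0, \<dots>, a m\<close>, where \<open>c\<close>
  assigns vertices to clusters and \<open>par\<close> arranges the clusters in a rooted tree as in
  \<open>weighted_tree\<close>. The bound 3 is the distance between the centres of two disjoint stars joined by an
  edge between their leaves.\<close>

definition clustering :: "nat \<Rightarrow> nat \<Rightarrow> 'a ugraph \<Rightarrow> 'a ugraph \<Rightarrow> nat \<Rightarrow> (nat \<Rightarrow> 'a) \<Rightarrow> (nat \<Rightarrow> nat) \<Rightarrow> ('a \<Rightarrow> nat) \<Rightarrow> bool" where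
  "clustering d C G T m a par c \<longleftrightarrow> tree T \<and> subgraph T G \<and> (\<forall>j. par j \<le> j - 1) \<and>
    (\<forall>v\<in>verts T. c v \<le> m \<and> steiner_distance T {v, a (c v)} \<le> d) \<and>
    (\<forall>j\<le>m. a j \<in> verts T \<and> C \<le> card {v \<in> verts T. c v = j}) \<and>
    (\<forall>j\<in>{1..m}. steiner_distance T {a j, a (par j)} \<le> 3)"

lemma tree_simple_connected: "tree T \<Longrightarrow> simple_graph T" "tree T \<Longrightarrow> connected_graph T"
  by (auto simp: tree_def)

lemma clustering_start:
  assumes G: "simple_graph G" and v: "v \<in> verts G"
  shows "\<exists>T a par c. clustering 1 (Suc (min_degree G)) G T 0 a par c"
proof -
  let ?K = "\<lparr>verts = {v}, edges = {}\<rparr>"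
  let ?T = "add_leaves ?K (nbhd G v) (\<lambda>_. v)"
  have "\<not> is_cycle ?K p" for p by (cases p) (auto simp: is_cycle_def)
  then have "tree ?K" by (simp add: tree_def simple_graph_def connected_graph_def)
  then have T: "tree ?T"
    using nbhd_simple[OF G, of v] by (intro tree_add_leaves) auto
  have "subgraph ?K G" using v by (auto simp: subgraph_def simple_graph_def)
  then have sub: "subgraph ?T G"
    using nbhd_simple[OF G, of v] by (intro add_leaves_subgraph) (auto simp: nbhd_def)
  have verts: "verts ?T = insert v (nbhd G v)" by (simp add: add_leaves_def)
  have near: "steiner_distance ?T {u, v} \<le> 1" if "u \<in> verts ?T" for u
  proof (cases "u = v")
    case True
    then show ?thesis using steiner_distance_singleton[of v ?T] verts by simp
  next
    case False
    then have "{u, v} \<in> edges ?T" using that by (auto simp: add_leaves_def)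
    then show ?thesis by (rule steiner_distance_edge[OF tree_simple_connected(1)[OF T]])
  qed
  have "clustering 1 (Suc (min_degree G)) G ?T 0 (\<lambda>_. v) (\<lambda>_. 0) (\<lambda>_. 0)"
    using T sub near min_degree_less_card_closed_nbhd[OF G v] by (simp add: clustering_def verts flip: insert_compr)
  then show ?thesis by blast
qed

lemma connected_graph_crossing_edge:
  assumes "connected_graph G" "u \<in> verts G" "u \<in> X" "v \<in> verts G" "v \<notin> X"
  obtains b x where "b \<in> X" "x \<notin> X" "{b, x} \<in> edges G"
proof -
  have "(u, v) \<in> {(x, y). {x, y} \<in> edges G}\<^sup>*"
    using assms(1,2,4) by (simp only: connected_graph_def)
  then have "v \<in> X \<or> (\<exists>b x. b \<in> X \<and> x \<notin> X \<and> {b, x} \<in> edges G)"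
  proof (induction rule: rtrancl_induct)
    case base
    then show ?case using assms(3) by simp
  next
    case (step y z)
    then show ?case by blast
  qed
  then show thesis using assms(5) that by blast
qed

text \<open>Among the vertices whose closed neighbourhoods miss \<open>T\<close>, connectedness gives one, \<open>b\<close>, with a
  neighbour \<open>x\<close> that is not of this kind. As \<open>x\<close> itself is outside \<open>T\<close>, it has a neighbour \<open>y\<close> in \<open>T\<close>.
  The new cluster is the closed neighbourhood of \<open>b\<close>, attached by the edge from \<open>x\<close> to \<open>y\<close>; its parent is
  the cluster of \<open>y\<close>, and the centres are joined by the path through \<open>x\<close> and \<open>y\<close>.\<close>

lemma clustering_extend:
  assumes G: "simple_graph G" "connected_graph G"
    and cl: "clustering 1 (Suc (min_degree G)) G T m a par c"
    and v: "v \<in> verts G" "insert v (nbhd G v) \<inter> verts T = {}"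
  shows "\<exists>T' m' a' par' c'. clustering 1 (Suc (min_degree G)) G T' m' a' par' c'
    \<and> card (verts T) < card (verts T')"
proof -
  have T: "tree T" "subgraph T G" and par: "\<And>j. par j \<le> j - 1"
    and c: "\<And>v. v \<in> verts T \<Longrightarrow> c v \<le> m" "\<And>v. v \<in> verts T \<Longrightarrow> steiner_distance T {v, a (c v)} \<le> 1"
    and a: "\<And>j. j \<le> m \<Longrightarrow> a j \<in> verts T"
    and size: "\<And>j. j \<le> m \<Longrightarrow> Suc (min_degree G) \<le> card {v \<in> verts T. c v = j}"
    and link: "\<And>j. j \<in> {1..m} \<Longrightarrow> steiner_distance T {a j, a (par j)} \<le> 3"
    using cl unfolding clustering_def by auto
  let ?N = "\<lambda>u. insert u (nbhd G u)"
  let ?X = "{u \<in> verts G. ?N u \<inter> verts T = {}}"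
  have TG: "verts T \<subseteq> verts G" using T(2) by (simp add: subgraph_def)
  obtain b x where b: "b \<in> ?X" and x: "x \<notin> ?X" and bx: "{b, x} \<in> edges G"
  proof (rule connected_graph_crossing_edge[OF G(2) v(1)])
    show "v \<in> ?X" using v by simp
    show "a 0 \<in> verts G" "a 0 \<notin> ?X" using a[of 0] TG by auto
  qed
  have xb: "x \<in> nbhd G b" using bx by (simp add: nbhd_def insert_commute)
  then have xT: "x \<notin> verts T" and xG: "x \<in> verts G" using b nbhd_simple(1)[OF G(1)] by auto
  then obtain y where y: "y \<in> verts T" "y \<in> nbhd G x" using x by auto
  have bT: "b \<notin> verts T" and bG: "b \<in> verts G" and NT: "?N b \<inter> verts T = {}" using b by auto
  have bx': "b \<noteq> x" using xb nbhd_simple(2)[OF G(1)] by auto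
  define T1 where "T1 = add_leaves T {x} (\<lambda>_. y)"
  define T2 where "T2 = add_leaves T1 {b} (\<lambda>_. x)"
  define T3 where "T3 = add_leaves T2 (nbhd G b - {x}) (\<lambda>_. b)"
  have v1: "verts T1 = insert x (verts T)" by (simp add: T1_def add_leaves_def)
  have v2: "verts T2 = {x, b} \<union> verts T" using v1 by (auto simp: T2_def add_leaves_def)
  have v3: "verts T3 = ?N b \<union> verts T" using v2 xb by (auto simp: T3_def add_leaves_def)
  have t1: "tree T1" "subgraph T1 G"
    unfolding T1_def using T xT xG y by (auto intro!: tree_add_leaves add_leaves_subgraph simp: nbhd_def insert_commute)
  have t2: "tree T2" "subgraph T2 G"
    unfolding T2_def using t1 v1 bT bG bx' bx by (auto intro!: tree_add_leaves add_leaves_subgraph)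
  have N: "nbhd G b - {x} \<subseteq> verts G" "finite (nbhd G b - {x})" "(nbhd G b - {x}) \<inter> verts T2 = {}"
    using nbhd_simple[OF G(1), of b] NT v2 by auto
  have t3: "tree T3" "subgraph T3 G"
    unfolding T3_def using t2 v2 N by (auto intro!: tree_add_leaves add_leaves_subgraph simp: nbhd_def)
  note T3 = tree_simple_connected[OF t3(1)]
  have edges3: "edges T \<subseteq> edges T3" and xy: "{x, y} \<in> edges T3"
    and nb: "\<And>w. w \<in> nbhd G b \<Longrightarrow> {w, b} \<in> edges T3"
    by (auto simp: T3_def T2_def T1_def add_leaves_def insert_commute)
  have "subgraph T T3" using edges3 v3 tree_simple_connected(1)[OF T(1)] by (auto simp: subgraph_def)
  then have keep: "steiner_distance T3 X \<le> steiner_distance T X" if "X \<subseteq> verts T" for X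
    using that T(1) tree_simple_connected(2) by (intro steiner_distance_antimono_graph) auto
  define a' where "a' = a(Suc m := b)"
  define par' where "par' = par(Suc m := c y)"
  define c' where "c' = (\<lambda>v. if v \<in> ?N b then Suc m else c v)"
  have old: "c' v = c v" "a' (c' v) = a (c v)" if "v \<in> verts T" for v
  proof -
    have "v \<notin> ?N b" using that NT by blast
    then show "c' v = c v" by (simp add: c'_def)
    then show "a' (c' v) = a (c v)" using c(1)[OF that] by (simp add: a'_def)
  qed
  have near: "c' v \<le> Suc m \<and> steiner_distance T3 {v, a' (c' v)} \<le> 1" if "v \<in> verts T3" for v
  proof (cases "v \<in> ?N b")
    case True
    have "steiner_distance T3 {v, b} \<le> 1"
    proof (cases "v = b")
      case True
      then show ?thesis using steiner_distance_singleton[of b T3] v3 by simp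
    next
      case False
      then show ?thesis using True nb steiner_distance_edge[OF T3(1)] by blast
    qed
    then show ?thesis using True by (simp add: c'_def a'_def)
  next
    case False
    then have vT: "v \<in> verts T" using that v3 by blast
    then show ?thesis
      using keep[of "{v, a (c v)}"] c[OF vT] a[OF c(1)[OF vT]] old[OF vT] by simp
  qed
  have size': "Suc (min_degree G) \<le> card {v \<in> verts T3. c' v = j}" if "j \<le> Suc m" for j
  proof (cases "j = Suc m")
    case True
    have "{v \<in> verts T3. c' v = j} = ?N b"
      using True v3 old c(1) by (auto simp: c'_def) fastforce+
    then show ?thesis using min_degree_less_card_closed_nbhd[OF G(1) bG] by simp
  next
    case False
    then have "{v \<in> verts T3. c' v = j} = {v \<in> verts T. c v = j}"
      using v3 NT by (auto simp: c'_def)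
    then show ?thesis using size[of j] that False by simp
  qed
  have link': "steiner_distance T3 {a' j, a' (par' j)} \<le> 3" if j: "j \<in> {1..Suc m}" for j
  proof (cases "j = Suc m")
    case True
    have ay: "a (c y) \<in> verts T" using a c(1) y(1) by blast
    have "steiner_distance T3 {b, a (c y)} \<le> steiner_distance T3 {b, x} + steiner_distance T3 {x, a (c y)}"
      using T3 v3 xb ay by (intro steiner_distance_trans) auto
    also have "steiner_distance T3 {x, a (c y)} \<le> steiner_distance T3 {x, y} + steiner_distance T3 {y, a (c y)}"
      using T3 v3 xb ay y(1) by (intro steiner_distance_trans) auto
    also have "steiner_distance T3 {b, x} \<le> 1"
      using steiner_distance_edge[OF T3(1) nb[OF xb]] by (simp add: insert_commute)
    also have "steiner_distance T3 {x, y} \<le> 1" using steiner_distance_edge[OF T3(1) xy] .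
    also have "steiner_distance T3 {y, a (c y)} \<le> 1"
      using keep[of "{y, a (c y)}"] c(2)[OF y(1)] ay y(1) by simp
    finally show ?thesis using True c(1)[OF y(1)] by (simp add: a'_def par'_def)
  next
    case False
    then have jm: "j \<in> {1..m}" using j by auto
    have "par j \<le> m" using par[of j] jm by auto
    then show ?thesis
      using jm keep[of "{a j, a (par j)}"] link[OF jm] a[of j] a[of "par j"] by (simp add: a'_def par'_def)
  qed
  have "clustering 1 (Suc (min_degree G)) G T3 (Suc m) a' par' c'"
    unfolding clustering_def
  proof (intro conjI allI ballI impI)
    fix j show "par' j \<le> j - 1" using par c(1)[OF y(1)] by (simp add: par'_def)
    show "a' j \<in> verts T3" if "j \<le> Suc m" using that a[of j] v3 by (auto simp: a'_def)
  qed (use t3 near size' link' in auto)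
  moreover have "verts T \<subset> verts T3" using v3 bT by auto
  then have "card (verts T) < card (verts T3)"
    using T3(1) by (intro psubset_card_mono) (auto simp: simple_graph_def)
  ultimately show ?thesis by blast
qed

lemma clustering_maximal:
  assumes G: "simple_graph G" "connected_graph G"
  shows "\<exists>T m a par c. clustering 1 (Suc (min_degree G)) G T m a par c
    \<and> (\<forall>v\<in>verts G. insert v (nbhd G v) \<inter> verts T \<noteq> {})"
proof -
  define P where "P T \<longleftrightarrow> (\<exists>m a par c. clustering 1 (Suc (min_degree G)) G T m a par c)" for T
  have "verts G \<noteq> {}" using G(2) by (simp only: connected_graph_def simp_thms)
  then obtain v where "v \<in> verts G" by blast
  then obtain T0 where T0: "P T0" using clustering_start[OF G(1)] unfolding P_def by blast
  have bound: "card (verts T) \<le> card (verts G)" if "P T" for T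
  proof (rule card_mono)
    show "finite (verts G)" using G(1) by (simp add: simple_graph_def)
    show "verts T \<subseteq> verts G" using that by (auto simp: P_def clustering_def subgraph_def)
  qed
  have "\<exists>T. P T \<and> (\<forall>T'. P T' \<longrightarrow> card (verts T') \<le> card (verts T))"
    using T0 bound by (intro ex_has_greatest_nat[of P T0 _ "Suc (card (verts G))"]) (auto simp: less_Suc_eq_le)
  then obtain T where T: "P T" and max: "\<And>T'. P T' \<Longrightarrow> card (verts T') \<le> card (verts T)"
    by blast
  obtain m a par c where cl: "clustering 1 (Suc (min_degree G)) G T m a par c"
    using T unfolding P_def by blast
  have "insert v (nbhd G v) \<inter> verts T \<noteq> {}" if v: "v \<in> verts G" for v
  proof
    assume "insert v (nbhd G v) \<inter> verts T = {}"
    from clustering_extend[OF G cl v this] obtain T' where "P T'" "card (verts T) < card (verts T')"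
      unfolding P_def by blast
    then show False using max[of T'] by simp
  qed
  then show ?thesis using cl by blast
qed

text \<open>In a maximal packing every vertex outside the tree has a neighbour in it. Hanging all these vertices
  on such neighbours and letting them join the clusters of those neighbours raises the radius from 1
  to 2 and leaves the centres and their distances as they were.\<close>

lemma spanning_clustering:
  assumes G: "simple_graph G" "connected_graph G"
  shows "\<exists>T m a par c. clustering 2 (Suc (min_degree G)) G T m a par c \<and> verts T = verts G"
proof -
  obtain T m a par c where cl: "clustering 1 (Suc (min_degree G)) G T m a par c"
    and dom: "\<And>v. v \<in> verts G \<Longrightarrow> insert v (nbhd G v) \<inter> verts T \<noteq> {}"
    using clustering_maximal[OF G] by blast
  have T: "tree T" "subgraph T G" and par: "\<And>j. par j \<le> j - 1"
    and c: "\<And>v. v \<in> verts T \<Longrightarrow> c v \<le> m" "\<And>v. v \<in> verts T \<Longrightarrow> steiner_distance T {v, a (c v)} \<le> 1"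
    and a: "\<And>j. j \<le> m \<Longrightarrow> a j \<in> verts T"
    and size: "\<And>j. j \<le> m \<Longrightarrow> Suc (min_degree G) \<le> card {v \<in> verts T. c v = j}"
    and link: "\<And>j. j \<in> {1..m} \<Longrightarrow> steiner_distance T {a j, a (par j)} \<le> 3"
    using cl unfolding clustering_def by auto
  let ?W = "verts G - verts T"
  have finG: "finite (verts G)" using G(1) by (simp add: simple_graph_def)
  have "\<forall>v\<in>?W. \<exists>u. u \<in> verts T \<and> {v, u} \<in> edges G"
    using dom by (fastforce simp: nbhd_def insert_commute)
  then obtain q where q: "\<And>v. v \<in> ?W \<Longrightarrow> q v \<in> verts T \<and> {v, q v} \<in> edges G" by metis
  define T' where "T' = add_leaves T ?W q"
  have W: "finite ?W" "?W \<inter> verts T = {}" "q ` ?W \<subseteq> verts T" using finG q by auto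
  have V: "verts T' = verts G" using T(2) by (auto simp: T'_def add_leaves_def subgraph_def)
  have T': "tree T'" "subgraph T' G" "subgraph T T'"
    unfolding T'_def using T W q
    by (auto intro!: tree_add_leaves add_leaves_subgraph subgraph_add_leaves)
  note sc = tree_simple_connected[OF T'(1)]
  have keep: "steiner_distance T' X \<le> steiner_distance T X" if "X \<subseteq> verts T" for X
    using that T(1) T'(3) tree_simple_connected(2) by (intro steiner_distance_antimono_graph) auto
  have TG: "verts T \<subseteq> verts G" using T(2) by (simp add: subgraph_def)
  define c' where "c' = (\<lambda>v. if v \<in> verts T then c v else c (q v))"
  have "c' v \<le> m \<and> steiner_distance T' {v, a (c' v)} \<le> 2" if v: "v \<in> verts T'" for v
  proof (cases "v \<in> verts T")
    case True
    then show ?thesis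
      using keep[of "{v, a (c v)}"] c[OF True] a[OF c(1)[OF True]] by (simp add: c'_def)
  next
    case False
    then have vW: "v \<in> ?W" using v V by blast
    then have qv: "q v \<in> verts T" using q by blast
    note aq = a[OF c(1)[OF qv]]
    have "{v, q v} \<in> edges T'" using vW by (auto simp: T'_def add_leaves_def)
    then have "steiner_distance T' {v, q v} \<le> 1" by (rule steiner_distance_edge[OF sc(1)])
    moreover have "steiner_distance T' {q v, a (c (q v))} \<le> 1"
      using keep[of "{q v, a (c (q v))}"] c(2)[OF qv] qv aq by simp
    moreover have "steiner_distance T' {v, a (c (q v))}
        \<le> steiner_distance T' {v, q v} + steiner_distance T' {q v, a (c (q v))}"
      using sc v V TG qv aq by (intro steiner_distance_trans) auto
    ultimately show ?thesis using False c(1)[OF qv] by (simp add: c'_def)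
  qed
  moreover have "Suc (min_degree G) \<le> card {v \<in> verts T'. c' v = j}" if "j \<le> m" for j
  proof -
    have "card {v \<in> verts T. c v = j} \<le> card {v \<in> verts T'. c' v = j}"
      using TG V finG by (intro card_mono) (auto simp: c'_def)
    then show ?thesis using size[OF that] by simp
  qed
  moreover have "steiner_distance T' {a j, a (par j)} \<le> 3" if "j \<in> {1..m}" for j
  proof -
    have "par j \<le> m" using par[of j] that by auto
    then show ?thesis using keep[of "{a j, a (par j)}"] link[OF that] a[of j] a[of "par j"] that by simp
  qed
  ultimately have "clustering 2 (Suc (min_degree G)) G T' m a par c'"
    using T' par a TG V by (auto simp: clustering_def)
  then show ?thesis using V by blast
qed

theorem theorem3:
  fixes G :: "'a ugraph" and k n \<delta> :: nat
  assumes "k > 0"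
    and "simple_graph G"
    and "connected_graph G"
    and "card (verts G) = n"
    and "min_degree G = \<delta>"
  shows "\<exists>T. spanning_tree T G \<and>
    real (steiner_wiener k T) \<le>
      (real k - 1) / (real k + 1) * (3 * (real n + 1) / (real \<delta> + 1)) * real (n choose k)
      + (3 * real \<delta> / (real \<delta> + 1) + 2 * real k) * real (n choose k)"
proof -
  obtain T m a par c where cl: "clustering 2 (Suc \<delta>) G T m a par c" and V: "verts T = verts G"
    using spanning_clustering[OF assms(2,3)] assms(5) by blast
  interpret weighted_tree par m "Suc \<delta>" "verts G" c
    using cl V assms(2) by unfold_locales (auto simp: clustering_def simple_graph_def)
  have T: "tree T" "subgraph T G" using cl by (auto simp: clustering_def)
  have "real (steiner_wiener k T) \<le>
      ((real k - 1) / (real k + 1) * (real 3 * (real (card (verts G)) + 1) / real (Suc \<delta>))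
      + (real 3 * (real (Suc \<delta>) - 1) / real (Suc \<delta>) + real 2 * real k)) * real (card (verts G) choose k)"
  proof (rule steiner_wiener_le[where a = a])
    show "simple_graph T" "connected_graph T" using T(1) tree_simple_connected by auto
  qed (use cl V assms(1) in \<open>auto simp: clustering_def\<close>)
  then have "real (steiner_wiener k T) \<le>
      (real k - 1) / (real k + 1) * (3 * (real n + 1) / (real \<delta> + 1)) * real (n choose k)
      + (3 * real \<delta> / (real \<delta> + 1) + 2 * real k) * real (n choose k)"
    unfolding assms(4) by (simp add: algebra_simps)
  moreover have "spanning_tree T G" using T V by (simp add: spanning_tree_def)
  ultimately show ?thesis by blast
qed

end
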